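(* Let $k,s,q$ be positive integers with $k\geq 4$ and $s\geq kq$. Let $T$ be a tree with $q$ edges. Let $\mathcal{F}^*$ be a $(k,s)$-homogeneous family with intersection pattern $\mathcal{J}$, and suppose that either $r(\mathcal{J})=k$, or $r(\mathcal{J})=k-1$ and $\mathcal{J}$ is of type 2. Then $\mathcal{F}^*$ contains a copy of $T^{(k)}$.
   Context: A family $\mathcal{F}\subseteq\binom{[n]}{k}$ is $k$-partite with $k$-partition $(X_1,\ldots,X_k)$ if $X_1,\ldots,X_k$ partition $[n]$ and $|F\cap X_i|=1$ for all $F\in\mathcal{F}$, $i\in[k]$. For $S\subseteq[n]$ its pattern is $\Pi(S)=\{i: S\cap X_i\neq\emptyset\}$, and $\Pi(\mathcal{L})=\{\Pi(S):S\in\mathcal{L}\}$. For $F\in\mathcal{F}$, $\mathcal{I}(F,\mathcal{F})=\{F\cap F': F'\in\mathcal{F},F'\neq F\}$. An $s$-star with kernel $A$ is a family of sets $F_1,\ldots,F_s$ with $F_i\cap F_j=A$ for all $i<j$. A family $\mathcal{F}^*\subseteq\binom{[n]}{k}$ is $(k,s)$-homogeneous with intersection pattern $\mathcal{J}$ if: $\mathcal{F}^*$ is $k$-partite with a $k$-partition $(X_1,\ldots,X_k)$; $\mathcal{J}$ is a family of proper subsets of $[k]$ with $\Pi(\mathcal{I}(F,\mathcal{F}^* ))=\mathcal{J}$ for all $F\in\mathcal{F}^*$; $\mathcal{J}$ is closed under intersection; and for every $F\in\mathcal{F}^*$ and every $A\in\mathcal{I}(F,\mathcal{F}^* )$ there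 is an $s$-star in $\mathcal{F}^*$ containing $F$ with kernel $A$. The rank of a family $\mathcal{L}$ of subsets of $[k]$ is $r(\mathcal{L})=\min\{|D|: D\subseteq[k],\ \text{no } B\in\mathcal{L}\text{ satisfies } D\subseteq B\}$. A family $\mathcal{L}$ of rank $k-1$ is of type 1 if there is $x\in[k]$ with $[k]\setminus\{x\}\notin\mathcal{L}$ but $[k]\setminus\{y\}\in\mathcal{L}$ for all $y\neq x$; otherwise it is of type 2. For a graph $H$, its $k$-blowup $H^{(k)}$ is the $k$-uniform hypergraph obtained by replacing each edge $xy$ of $H$ by a $k$-set $E_{xy}$ consisting of $x$, $y$ and $k-2$ new vertices, where the new vertex sets $E_{xy}\setminus\{x,y\}$ are pairwise disjoint for distinct edges. A family contains a copy of a hypergraph if some subfamily is isomorphic to it. *)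

theory Defs
  imports "HOL-Library.Disjoint_Sets"
begin

definition uniform_family :: "nat \<Rightarrow> nat \<Rightarrow> nat set set \<Rightarrow> bool" where
  "uniform_family n k \<F> \<longleftrightarrow> \<F> \<subseteq> {A. A \<subseteq> {1..n} \<and> card A = k}"

text \<open>Parts are not required to be nonempty; this is automatic as soon as the
  partite family has a member.\<close>

definition partition_into :: "nat \<Rightarrow> nat \<Rightarrow> (nat \<Rightarrow> nat set) \<Rightarrow> bool" where
  "partition_into n k X \<longleftrightarrow> (\<Union>i\<in>{1..k}. X i) = {1..n} \<and> disjoint_family_on X {1..k}"

definition k_partite :: "nat \<Rightarrow> nat \<Rightarrow> (nat \<Rightarrow> nat set) \<Rightarrow> nat set set \<Rightarrow> bool" where
  "k_partite n k X \<F> \<longleftrightarrow>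
     uniform_family n k \<F> \<and> partition_into n k X \<and>
     (\<forall>F\<in>\<F>. \<forall>i\<in>{1..k}. card (F \<inter> X i) = 1)"

definition pattern :: "nat \<Rightarrow> (nat \<Rightarrow> nat set) \<Rightarrow> nat set \<Rightarrow> nat set" where
  "pattern k X S = {i \<in> {1..k}. S \<inter> X i \<noteq> {}}"

definition intersections :: "'a set \<Rightarrow> 'a set set \<Rightarrow> 'a set set" where
  "intersections F \<F> = {F \<inter> F' | F'. F' \<in> \<F> \<and> F' \<noteq> F}"

text \<open>The members of a star are distinct.  A repetition \<open>B, B\<close> in an indexed star would force
  \<open>B = A\<close>, which is impossible for the kernels used below.\<close>

definition is_star :: "nat \<Rightarrow> 'a set \<Rightarrow> 'a set set \<Rightarrow> bool" where
  "is_star s A S \<longleftrightarrow> finite S \<and> card S = s \<and> pairwise (\<lambda>B C. B \<inter> C = A) S"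

text \<open>The empty family is homogeneous for every intersection-closed \<open>\<J>\<close> of proper subsets, so
  nonemptiness has to be assumed separately where it matters.\<close>

definition homogeneous :: "nat \<Rightarrow> nat \<Rightarrow> nat \<Rightarrow> nat set set \<Rightarrow> nat set set \<Rightarrow> bool" where
  "homogeneous n k s \<F> \<J> \<longleftrightarrow>
     (\<exists>X. k_partite n k X \<F> \<and>
          (\<forall>B\<in>\<J>. B \<subset> {1..k}) \<and>
          (\<forall>F\<in>\<F>. pattern k X ` intersections F \<F> = \<J>) \<and>
          (\<forall>A\<in>\<J>. \<forall>B\<in>\<J>. A \<inter> B \<in> \<J>) \<and>
          (\<forall>F\<in>\<F>. \<forall>A\<in>intersections F \<F>. \<exists>S\<subseteq>\<F>. F \<in> S \<and> is_star s A S))"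

text \<open>The set minimised over contains \<open>{1..k}\<close>, and hence is nonempty, whenever all members of
  the family are proper subsets of \<open>{1..k}\<close>.\<close>

definition rank :: "nat \<Rightarrow> nat set set \<Rightarrow> nat" where
  "rank k \<L> = Min (card ` {D. D \<subseteq> {1..k} \<and> \<not> (\<exists>B\<in>\<L>. D \<subseteq> B)})"

definition type1 :: "nat \<Rightarrow> nat set set \<Rightarrow> bool" where
  "type1 k \<L> \<longleftrightarrow> rank k \<L> = k - 1 \<and>
     (\<exists>x\<in>{1..k}. {1..k} - {x} \<notin> \<L> \<and> (\<forall>y\<in>{1..k}. y \<noteq> x \<longrightarrow> {1..k} - {y} \<in> \<L>))"

definition type2 :: "nat \<Rightarrow> nat set set \<Rightarrow> bool" where
  "type2 k \<L> \<longleftrightarrow> rank k \<L> = k - 1 \<and> \<not> type1 k \<L>"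

definition simple_graph :: "'v set \<Rightarrow> 'v set set \<Rightarrow> bool" where
  "simple_graph V E \<longleftrightarrow> finite V \<and> (\<forall>e\<in>E. e \<subseteq> V \<and> card e = 2)"

definition graph_connected :: "'v set \<Rightarrow> 'v set set \<Rightarrow> bool" where
  "graph_connected V E \<longleftrightarrow>
     V \<noteq> {} \<and> (\<forall>u\<in>V. \<forall>v\<in>V. (u, v) \<in> {(x, y). {x, y} \<in> E}\<^sup>*)"

definition is_cycle :: "'v set set \<Rightarrow> 'v list \<Rightarrow> bool" where
  "is_cycle E vs \<longleftrightarrow> length vs \<ge> 3 \<and> distinct vs \<and>
     (\<forall>i<length vs. {vs ! i, vs ! (Suc i mod length vs)} \<in> E)"

definition is_tree :: "'v set \<Rightarrow> 'v set set \<Rightarrow> bool" where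
  "is_tree V E \<longleftrightarrow> simple_graph V E \<and> graph_connected V E \<and> \<not> (\<exists>vs. is_cycle E vs)"

text \<open>The original vertices are tagged with \<open>Inl\<close>; the \<open>k - 2\<close> new vertices of the edge \<open>e\<close>
  are \<open>Inr (e, j)\<close> with \<open>j < k - 2\<close>, so distinct edges get disjoint sets of new vertices.\<close>

definition blowup_edge :: "nat \<Rightarrow> 'v set \<Rightarrow> ('v + 'v set \<times> nat) set" where
  "blowup_edge k e = Inl ` e \<union> Inr ` ({e} \<times> {..<k - 2})"

definition blowup :: "nat \<Rightarrow> 'v set set \<Rightarrow> ('v + 'v set \<times> nat) set set" where
  "blowup k E = blowup_edge k ` E"

text \<open>A hypergraph is represented by its set of edges, its vertices being those covered by the
  edges.  For the blowup of a tree with at least one edge this loses nothing, since such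
  a tree has no isolated vertices.\<close>

definition hypergraph_iso :: "'a set set \<Rightarrow> 'b set set \<Rightarrow> bool" where
  "hypergraph_iso \<H> \<G> \<longleftrightarrow> (\<exists>f. bij_betw f (\<Union>\<H>) (\<Union>\<G>) \<and> (`) f ` \<H> = \<G>)"

definition contains_copy :: "'b set set \<Rightarrow> 'a set set \<Rightarrow> bool" where
  "contains_copy \<F> \<H> \<longleftrightarrow> (\<exists>\<G>\<subseteq>\<F>. hypergraph_iso \<H> \<G>)"

end

theory Submission
  imports Defs
begin

text \<open>The rank and type hypotheses, together with closure under intersection, put at least two
  singletons \<open>{a}\<close> and \<open>{b}\<close> into \<open>\<J>\<close>.  Hence every vertex in the parts \<open>X a\<close> and \<open>X b\<close>
  is the kernel of a large star through each edge containing it, and every edge has a vertex in both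
  parts.  Building the tree by adding pendant edges, one always places the tree vertices in
  \<open>X a \<union> X b\<close>; some member of the star at the vertex to be extended avoids all other vertices
  used so far, since these are fewer than the members of the star.\<close>

section \<open>Trees built from pendant edges\<close>

text \<open>Rule induction on this predicate adds one leaf at a time, which is the recursion that
  the embedding follows. By \<open>tree_grown\<close> every tree arises in this way.\<close>

inductive grown :: "'v set \<Rightarrow> 'v set set \<Rightarrow> bool" where
  base: "grown {r} {}"
| step: "grown W E \<Longrightarrow> x \<in> W \<Longrightarrow> y \<notin> W \<Longrightarrow> grown (insert y W) (insert {x, y} E)"

lemma grown_finite:
  assumes "grown W E"
  shows "finite W" "finite E" "\<Union>E \<subseteq> W" "card W = Suc (card E)"
proof -
  have "finite W \<and> finite E \<and> \<Union>E \<subseteq> W \<and> card W = Suc (card E)"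
    using assms
  proof (induction rule: grown.induct)
    case (base r)
    then show ?case by simp
  next
    case (step W E x y)
    then have "{x, y} \<notin> E" by blast
    with step show ?case by auto
  qed
  then show "finite W" "finite E" "\<Union>E \<subseteq> W" "card W = Suc (card E)" by auto
qed

text \<open>Serves to show that a grown subtree spanning a tree misses none of its edges: such a
  path and a missing edge would form a cycle. Simple paths replace reachability because
  \<open>is_cycle\<close> asks for distinct vertices.\<close>

lemma grown_path:
  assumes "grown W E" "u \<in> W" "v \<in> W"
  shows "\<exists>p. p \<noteq> [] \<and> distinct p \<and> set p \<subseteq> W \<and> hd p = u \<and> last p = v \<and>
    successively (\<lambda>a b. {a, b} \<in> E) p"
  using assms
proof (induction arbitrary: u v rule: grown.induct)
  case (base r)
  then show ?case by (intro exI[of _ "[r]"]) auto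
next
  case (step W E x y)
  let ?P = "\<lambda>u v p. p \<noteq> [] \<and> distinct p \<and> set p \<subseteq> insert y W \<and> hd p = u \<and> last p = v \<and>
    successively (\<lambda>a b. {a, b} \<in> insert {x, y} E) p"
  \<comment> \<open>The extra bound \<open>set p \<subseteq> W\<close> keeps \<open>y\<close> off
    the path, so \<open>y\<close> can be attached at either end without a repetition.\<close>
  have inW: "\<exists>p. ?P u v p \<and> set p \<subseteq> W" if uv: "u \<in> W" "v \<in> W" for u v
  proof -
    obtain p where p: "p \<noteq> []" "distinct p" "set p \<subseteq> W" "hd p = u" "last p = v"
      "successively (\<lambda>a b. {a, b} \<in> E) p"
      using step.IH[OF uv] by blast
    from p(6) have "successively (\<lambda>a b. {a, b} \<in> insert {x, y} E) p"
      by (rule successively_mono) auto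
    with p show ?thesis by blast
  qed
  have to_y: "\<exists>p. ?P u y p" if u: "u \<in> W" for u
  proof -
    obtain p where p: "?P u x p" "set p \<subseteq> W" using inW[OF u step.hyps(2)] by blast
    have "?P u y (p @ [y])" using p step.hyps(3) by (auto simp: successively_append_iff)
    then show ?thesis by blast
  qed
  have from_y: "\<exists>p. ?P y v p" if v: "v \<in> W" for v
  proof -
    obtain p where p: "?P x v p" "set p \<subseteq> W" using inW[OF step.hyps(2) v] by blast
    have "?P y v (y # p)" using p step.hyps(3)
      by (auto simp: successively_Cons insert_commute)
    then show ?thesis by blast
  qed
  consider "u \<in> W" "v \<in> W" | "u \<in> W" "v = y" | "u = y" "v \<in> W" | "u = y" "v = y"
    using step.prems by blast
  then show ?case
  proof cases
    case 1
    then show ?thesis using inW by blast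
  next
    case 2
    then show ?thesis using to_y by blast
  next
    case 3
    then show ?thesis using from_y by blast
  next
    case 4
    then show ?thesis by (intro exI[of _ "[y]"]) auto
  qed
qed

text \<open>A walk from a vertex of \<open>W\<close> to a vertex outside has a first step that
  leaves \<open>W\<close>.\<close>

lemma connected_crossing_edge:
  assumes "graph_connected V E" "W \<subset> V" "W \<noteq> {}"
  obtains x y where "x \<in> W" "y \<notin> W" "{x, y} \<in> E"
proof -
  obtain u v where uv: "u \<in> W" "u \<in> V" "v \<in> V" "v \<notin> W" using assms(2,3) by blast
  then have "(u, v) \<in> {(x, y). {x, y} \<in> E}\<^sup>*"
    using assms(1) by (auto simp: graph_connected_def)
  then have "v \<notin> W \<longrightarrow> (\<exists>x y. x \<in> W \<and> y \<notin> W \<and> {x, y} \<in> E)"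
    by (induction rule: rtrancl_induct) (use uv in auto)
  then show ?thesis using uv that by blast
qed

text \<open>The path does not use the edge \<open>{u, v}\<close>, so it has a third vertex, and that
  edge closes it.\<close>

lemma path_edge_cycle:
  assumes "distinct p" "p \<noteq> []" "hd p = u" "last p = v" "u \<noteq> v"
    and p: "successively (\<lambda>a b. {a, b} \<in> E') p"
    and "E' \<subseteq> E" "{u, v} \<in> E" "{u, v} \<notin> E'"
  shows "is_cycle E p"
proof -
  have len: "length p \<ge> 3"
  proof (rule ccontr)
    assume "\<not> ?thesis"
    then have "length p = 1 \<or> length p = 2"
      using assms(2) length_0_conv[of p] by linarith
    \<comment> \<open>One vertex would force \<open>u = v\<close>; two would make
      \<open>{u, v}\<close> an edge of \<open>E'\<close>.\<close>
    then show False
      using assms by (auto simp: length_Suc_conv numeral_2_eq_2)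
  qed
  have "{p ! i, p ! (Suc i mod length p)} \<in> E" if "i < length p" for i
  proof (cases "Suc i < length p")
    case True
    then show ?thesis using p assms(7) by (auto simp: successively_conv_nth)
  next
    case False
    \<comment> \<open>The successor index wraps to 0, so this is the closing edge from
      \<open>last p\<close> to \<open>hd p\<close>.\<close>
    then have "i = length p - 1" "Suc i = length p" using that by auto
    then show ?thesis
      using assms by (auto simp: hd_conv_nth last_conv_nth insert_commute)
  qed
  with len assms(1) show ?thesis by (simp add: is_cycle_def)
qed

text \<open>Connectedness lets a grown subtree be enlarged by a crossing edge until it spans
  \<open>V\<close>; acyclicity then forbids any edge of \<open>E\<close> outside it.\<close>

lemma tree_grown:
  assumes "is_tree V E"
  shows "grown V E"
proof -
  have fV: "finite V" and edges: "\<And>e. e \<in> E \<Longrightarrow> e \<subseteq> V \<and> card e = 2"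
    and con: "graph_connected V E" and acyc: "\<And>p. \<not> is_cycle E p"
    using assms by (auto simp: is_tree_def simple_graph_def)
  have "\<exists>W E'. grown W E' \<and> W \<subseteq> V \<and> E' \<subseteq> E \<and> card W = Suc m" if "m < card V" for m
    using that
  proof (induction m)
    case 0
    obtain r where "r \<in> V" using con by (auto simp: graph_connected_def)
    then show ?case by (intro exI[of _ "{r}"] exI[of _ "{}"]) (auto intro: grown.base)
  next
    case (Suc m)
    then obtain W E' where W: "grown W E'" "W \<subseteq> V" "E' \<subseteq> E" "card W = Suc m" by auto
    then have "W \<subset> V" "W \<noteq> {}" using Suc.prems by auto
    then obtain x y where xy: "x \<in> W" "y \<notin> W" "{x, y} \<in> E"
      using connected_crossing_edge[OF con] by blast
    have "grown (insert y W) (insert {x, y} E')" using W(1) xy by (intro grown.step)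
    moreover have "card (insert y W) = Suc (Suc m)"
      using W xy grown_finite(1)[OF W(1)] by simp
    ultimately show ?case using W xy edges[OF xy(3)]
      by (intro exI[of _ "insert y W"] exI[of _ "insert {x, y} E'"]) auto
  qed
  moreover have cV: "card V > 0" using con fV by (auto simp: graph_connected_def card_gt_0_iff)
  ultimately have "\<exists>W E'. grown W E' \<and> W \<subseteq> V \<and> E' \<subseteq> E \<and> card W = Suc (card V - 1)"
    by (metis diff_less zero_less_one)
  then obtain W E' where W: "grown W E'" "W \<subseteq> V" "E' \<subseteq> E" "card W = card V"
    using cV by auto
  have WV: "W = V" using W fV by (simp add: card_subset_eq)
  have "E \<subseteq> E'"
  proof
    fix e assume e: "e \<in> E"
    obtain u v where uv: "e = {u, v}" "u \<noteq> v" using edges[OF e] card_2_iff by metis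
    then have "u \<in> W" "v \<in> W" using edges[OF e] WV by auto
    then obtain p where p: "p \<noteq> []" "distinct p" "hd p = u" "last p = v"
      "successively (\<lambda>a b. {a, b} \<in> E') p"
      using grown_path[OF W(1)] by blast
    show "e \<in> E'"
    proof (rule ccontr)
      assume "e \<notin> E'"
      then have "is_cycle E p"
        using path_edge_cycle[OF p(2,1,3,4) uv(2) p(5) W(3)] e uv(1) by simp
      with acyc show False by simp
    qed
  qed
  with W WV show ?thesis by auto
qed

section \<open>Embedding blowups of trees\<close>

text \<open>Members of the star are disjoint outside \<open>v\<close>. If each met \<open>U\<close>
  outside \<open>v\<close>, choosing such points would inject \<open>S\<close> into
  \<open>U - {v}\<close>, which is too small.\<close>

lemma star_avoiding_member:
  assumes star: "is_star s {v} S" and F: "F \<in> S" "v \<in> F"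
    and U: "finite U" "card (U - {v}) < s"
  obtains B where "B \<in> S" "v \<in> B" "B \<inter> U \<subseteq> {v}"
proof (rule ccontr)
  assume "\<not> thesis"
  have fS: "finite S" "card S = s" and disj: "\<And>B C. B \<in> S \<Longrightarrow> C \<in> S \<Longrightarrow> B \<noteq> C \<Longrightarrow> B \<inter> C = {v}"
    using star by (auto simp: is_star_def pairwise_def)
  \<comment> \<open>That \<open>F\<close> contains \<open>v\<close> matters when \<open>S\<close>
    has a single member, since \<open>is_star\<close> then puts no condition on the kernel.\<close>
  have "v \<in> B" if "B \<in> S" for B using disj[OF that F(1)] F(2) by blast
  with \<open>\<not> thesis\<close> have "\<forall>B\<in>S. \<exists>u. u \<in> B \<inter> U - {v}" using that by blast
  then obtain g where g: "\<And>B. B \<in> S \<Longrightarrow> g B \<in> B \<inter> U - {v}" by metis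
  have "inj_on g S"
  proof (rule inj_onI)
    fix B C assume BC: "B \<in> S" "C \<in> S" "g B = g C"
    then show "B = C" using g[of B] g[of C] disj[of B C] by auto
  qed
  then have "card S \<le> card (U - {v})"
    using g U(1) by (intro card_inj_on_le) auto
  with U fS show False by simp
qed

text \<open>Differs from the union of the blowup edges in the base case: a single vertex without
  edges still has to receive an image.\<close>

definition blowup_vertices :: "nat \<Rightarrow> 'v set \<Rightarrow> 'v set set \<Rightarrow> ('v + 'v set \<times> nat) set" where
  "blowup_vertices k W E = Inl ` W \<union> Inr ` (E \<times> {..<k - 2})"

lemma card_blowup_vertices:
  assumes "grown W E" "k \<ge> 2"
  shows "finite (blowup_vertices k W E)" "card (blowup_vertices k W E) = (k - 1) * card E + 1"
proof -
  note fin = grown_finite[OF assms(1)]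
  show "finite (blowup_vertices k W E)" using fin by (simp add: blowup_vertices_def)
  have "card (blowup_vertices k W E) = card W + card E * (k - 2)"
    unfolding blowup_vertices_def using fin
    by (subst card_Un_disjoint) (auto simp: card_image card_cartesian_product)
  also have "\<dots> = (k - 1) * card E + 1"
    using assms(2) fin(4) by (cases k; cases "k - 1") (auto simp: algebra_simps)
  finally show "card (blowup_vertices k W E) = (k - 1) * card E + 1" .
qed

text \<open>Homogeneity enters only through \<open>R\<close>: its vertices are kernels of stars
  through each member containing them, and each member has at least two of them. Sending tree
  vertices into \<open>R \<inter> \<Union>\<F>\<close> is the invariant that makes a star available
  wherever the next edge is attached. The bound on \<open>s\<close> counts the vertices, apart from
  the attachment point, occupied before the last edge.\<close>

lemma grown_blowup_embedding:
  fixes \<F> :: "'a set set" and R :: "'a set"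
  assumes "grown W E" "card E \<le> q" and k: "k \<ge> 2" and s: "s > (k - 1) * (q - 1)"
    and ne: "\<F> \<noteq> {}" and card_k: "\<And>F. F \<in> \<F> \<Longrightarrow> card F = k"
    and star: "\<And>F v. F \<in> \<F> \<Longrightarrow> v \<in> F \<Longrightarrow> v \<in> R \<Longrightarrow> \<exists>S\<subseteq>\<F>. F \<in> S \<and> is_star s {v} S"
    and two: "\<And>F v. F \<in> \<F> \<Longrightarrow> \<exists>w\<in>F \<inter> R. w \<noteq> v"
  shows "\<exists>f. inj_on f (blowup_vertices k W E) \<and> (\<forall>w\<in>W. f (Inl w) \<in> R \<inter> \<Union>\<F>) \<and>
    (\<forall>e\<in>E. f ` blowup_edge k e \<in> \<F>)"
  using assms(1,2)
proof (induction rule: grown.induct)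
  case (base r)
  obtain F where "F \<in> \<F>" using ne by blast
  then obtain w where "w \<in> F \<inter> R" using two by blast
  with \<open>F \<in> \<F>\<close> show ?case
    by (intro exI[of _ "\<lambda>_. w"]) (auto simp: blowup_vertices_def)
next
  case (step W E x y)
  note fin = grown_finite[OF step.hyps(1)]
  let ?D = "blowup_vertices k W E" and ?e = "{x, y}"
  have new: "?e \<notin> E" using fin(3) step.hyps(3) by blast
  then have cE: "card E + 1 \<le> q" using step.prems fin(2) by simp
  with step.IH obtain f where f: "inj_on f ?D" "\<And>w. w \<in> W \<Longrightarrow> f (Inl w) \<in> R \<inter> \<Union>\<F>"
    "\<And>e. e \<in> E \<Longrightarrow> f ` blowup_edge k e \<in> \<F>" by auto
  define v where "v = f (Inl x)"
  obtain F where F: "F \<in> \<F>" "v \<in> F" "v \<in> R" using f(2)[OF step.hyps(2)] v_def by blast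
  obtain S where S: "S \<subseteq> \<F>" "F \<in> S" "is_star s {v} S" using star[OF F] by blast
  have xD: "Inl x \<in> ?D" using step.hyps(2) by (simp add: blowup_vertices_def)
  have "card (f ` ?D - {v}) < s"
  proof -
    \<comment> \<open>Deleting \<open>v\<close> cancels the summand 1 in
      \<open>card_blowup_vertices\<close>.\<close>
    have "card (f ` ?D - {v}) = (k - 1) * card E"
      using card_blowup_vertices[OF step.hyps(1) k] f(1) xD
      by (simp add: card_image v_def)
    also have "\<dots> \<le> (k - 1) * (q - 1)" using cE by (intro mult_le_mono2) simp
    finally show ?thesis using s by simp
  qed
  then obtain B where B: "B \<in> S" "v \<in> B" "B \<inter> f ` ?D \<subseteq> {v}"
    using star_avoiding_member[OF S(3,2) F(2)] card_blowup_vertices(1)[OF step.hyps(1) k]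
    by blast
  have BF: "B \<in> \<F>" using B S by blast
  \<comment> \<open>\<open>w\<close> will be the image of \<open>y\<close>; taking it from
    \<open>R\<close> preserves the invariant.\<close>
  obtain w where w: "w \<in> B" "w \<in> R" "w \<noteq> v" using two[OF BF] by blast
  \<comment> \<open>An infinite set has \<open>card\<close> 0, whereas \<open>card B = k\<close> is
    at least 2.\<close>
  have fB: "finite B" using card_k[OF BF] k by (metis card.infinite not_numeral_le_zero)
  have "card (B - {v, w}) = k - 2"
    using card_k[OF BF] B(2) w fB by (simp add: card_Diff_subset)
  then obtain g where g: "bij_betw g {..<k - 2} (B - {v, w})"
    using ex_bij_betw_nat_finite[of "B - {v, w}"] fB by (auto simp: lessThan_atLeast0)
  define f' where "f' z = (case z of Inl u \<Rightarrow> if u = y then w else f z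
    | Inr (e, j) \<Rightarrow> if e = ?e then g j else f z)" for z
  have old: "f' z = f z" if "z \<in> ?D" for z
    using that step.hyps(3) new by (auto simp: f'_def blowup_vertices_def)
  have f'y: "f' (Inl y) = w" by (simp add: f'_def)
  have f'e: "f' (Inr (?e, j)) = g j" for j by (simp add: f'_def)
  \<comment> \<open>These are the vertices of the new edge other than \<open>Inl x\<close>, whose
    image \<open>v\<close> stays fixed. They are sent onto \<open>B - {v}\<close>, which misses the
    old image by the choice of \<open>B\<close>.\<close>
  let ?N = "insert (Inl y) ((\<lambda>j. Inr (?e, j)) ` {..<k - 2})"
  have D': "blowup_vertices k (insert y W) (insert ?e E) = ?D \<union> ?N"
    by (auto simp: blowup_vertices_def)
  have img: "f' ` ?N = B - {v}"
  proof -
    have "f' ` ?N = insert w (g ` {..<k - 2})" by (simp add: f'y image_image f'e)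
    also have "\<dots> = B - {v}" using g w by (auto simp: bij_betw_def)
    finally show ?thesis .
  qed
  have inj_old: "inj_on f' ?D" using f(1) old by (simp cong: inj_on_cong)
  have inj_new: "inj_on f' ?N"
    using g by (auto simp: inj_on_def bij_betw_def f'y f'e)
  have "inj_on f' (?D \<union> ?N)"
  proof (subst inj_on_Un, intro conjI)
    have "f' ` ?D = f ` ?D" using old by (intro image_cong) auto
    then have "f' ` ?D \<inter> f' ` ?N = {}" using img B(3) by blast
    then show "f' ` (?D - ?N) \<inter> f' ` (?N - ?D) = {}" by blast
  qed (use inj_old inj_new in auto)
  moreover have "f' (Inl u) \<in> R \<inter> \<Union>\<F>" if "u \<in> insert y W" for u
    using that w BF f(2) by (auto simp: f'_def)
  moreover have "f' ` blowup_edge k e \<in> \<F>" if "e \<in> insert ?e E" for e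
  proof (cases "e = ?e")
    case True
    have "blowup_edge k ?e = insert (Inl x) ?N" by (auto simp: blowup_edge_def)
    then have "f' ` blowup_edge k ?e = insert (f' (Inl x)) (f' ` ?N)" by simp
    also have "\<dots> = B" using img old[OF xD] v_def B(2) by auto
    finally show ?thesis using True BF by simp
  next
    case False
    then have e: "e \<in> E" using that by blast
    then have "blowup_edge k e \<subseteq> ?D"
      using fin(3) by (auto simp: blowup_edge_def blowup_vertices_def)
    then have "f' ` blowup_edge k e = f ` blowup_edge k e"
      using old by (intro image_cong) auto
    then show ?thesis using f(3)[OF e] by simp
  qed
  ultimately show ?case unfolding D' by (intro exI[of _ f']) blast
qed

lemma contains_copyI:
  assumes "inj_on f (\<Union>\<H>)" "\<And>H. H \<in> \<H> \<Longrightarrow> f ` H \<in> \<F>"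
  shows "contains_copy \<F> \<H>"
proof -
  have "bij_betw f (\<Union>\<H>) (\<Union>((`) f ` \<H>))"
    using assms(1) by (simp add: bij_betw_def image_Union)
  then show ?thesis using assms(2) unfolding contains_copy_def hypergraph_iso_def
    by (intro exI[of _ "(`) f ` \<H>"]) blast
qed

section \<open>Singletons in the intersection pattern\<close>

lemma covered_if_card_less_rank:
  assumes "D \<subseteq> {1..k}" "card D < rank k \<L>"
  shows "\<exists>B\<in>\<L>. D \<subseteq> B"
proof (rule ccontr)
  assume "\<not> ?thesis"
  then have "rank k \<L> \<le> card D" unfolding rank_def
    using assms(1) by (intro Min_le) (auto intro!: finite_imageI)
  with assms(2) show False by simp
qed

lemma Inter_image_closed:
  assumes "finite A" "A \<noteq> {}" "\<And>x. x \<in> A \<Longrightarrow> f x \<in> \<J>"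
    and "\<And>B C. B \<in> \<J> \<Longrightarrow> C \<in> \<J> \<Longrightarrow> B \<inter> C \<in> \<J>"
  shows "\<Inter>(f ` A) \<in> \<J>"
  using assms(1-3)
proof (induction rule: finite_ne_induct)
  case (singleton x)
  then show ?case by simp
next
  case (insert x A)
  then have "f x \<inter> \<Inter>(f ` A) \<in> \<J>" by (intro assms(4)) simp_all
  then show ?case by simp
qed

text \<open>For each \<open>j\<close> other than \<open>i\<close>, choose a member that contains
  \<open>i\<close> but not \<open>j\<close>; the intersection of all these is \<open>{i}\<close>. As
  \<open>k \<ge> 2\<close>, at least one member is being intersected.\<close>

lemma singleton_in_pattern:
  fixes k :: nat
  assumes k: "k \<ge> 2" and proper: "\<And>B. B \<in> \<J> \<Longrightarrow> B \<subset> {1..k}"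
    and cl: "\<And>B C. B \<in> \<J> \<Longrightarrow> C \<in> \<J> \<Longrightarrow> B \<inter> C \<in> \<J>"
    and i: "i \<in> {1..k}"
    and sep: "\<And>j. j \<in> {1..k} \<Longrightarrow> j \<noteq> i \<Longrightarrow> \<exists>B\<in>\<J>. i \<in> B \<and> j \<notin> B"
  shows "{i} \<in> \<J>"
proof -
  obtain f where f: "\<And>j. j \<in> {1..k} - {i} \<Longrightarrow> f j \<in> \<J> \<and> i \<in> f j \<and> j \<notin> f j"
    using sep by (metis Diff_iff singletonI)
  have "card ({1..k} - {i}) = k - 1" using i by simp
  then have "card ({1..k} - {i}) > 0" using k by simp
  then have ne: "{1..k} - {i} \<noteq> {}" using card_gt_0_iff by blast
  have mem: "\<Inter>(f ` ({1..k} - {i})) \<in> \<J>"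
    using f by (intro Inter_image_closed[OF _ ne _ cl]) simp_all
  have "\<Inter>(f ` ({1..k} - {i})) = {i}"
  proof
    show "\<Inter>(f ` ({1..k} - {i})) \<subseteq> {i}"
    proof
      fix j assume j: "j \<in> \<Inter>(f ` ({1..k} - {i}))"
      have "\<Inter>(f ` ({1..k} - {i})) \<subseteq> {1..k}" using proper[OF mem] by (rule psubset_imp_subset)
      then have "j \<in> {1..k}" using j by (rule subsetD)
      then show "j \<in> {i}" using j f[of j] by auto
    qed
    show "{i} \<subseteq> \<Inter>(f ` ({1..k} - {i}))" using f by blast
  qed
  with mem show ?thesis by simp
qed

text \<open>Rank at least \<open>k - 1\<close> means that every set of \<open>k - 2\<close> indices
  is covered, and the hypotheses exclude that exactly one set of \<open>k - 1\<close> indices is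
  missing. Both facts supply the separating members for \<open>singleton_in_pattern\<close>.\<close>

lemma two_singletons_in_pattern:
  assumes k: "k \<ge> 4" and proper: "\<And>B. B \<in> \<J> \<Longrightarrow> B \<subset> {1..k}"
    and cl: "\<And>B C. B \<in> \<J> \<Longrightarrow> C \<in> \<J> \<Longrightarrow> B \<inter> C \<in> \<J>"
    and rk: "rank k \<J> = k \<or> (rank k \<J> = k - 1 \<and> type2 k \<J>)"
  obtains a b where "a \<in> {1..k}" "b \<in> {1..k}" "a \<noteq> b" "{a} \<in> \<J>" "{b} \<in> \<J>"
proof -
  define M where "M = {x \<in> {1..k}. {1..k} - {x} \<notin> \<J>}"
  \<comment> \<open>At rank \<open>k\<close> a proper subset covering \<open>{1..k} - {x}\<close>
    must equal it, so \<open>x \<notin> M\<close>. At rank \<open>k - 1\<close> a single element of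
    \<open>M\<close> is precisely type 1.\<close>
  have M_not_single: "M \<noteq> {x}" for x
  proof
    assume M: "M = {x}"
    then have "x \<in> M" by simp
    then have x: "x \<in> {1..k}" "{1..k} - {x} \<notin> \<J>" by (simp_all add: M_def)
    have others: "{1..k} - {y} \<in> \<J>" if "y \<in> {1..k}" "y \<noteq> x" for y
    proof -
      have "y \<notin> M" using M that by simp
      then show ?thesis using that by (simp add: M_def)
    qed
    from rk show False
    proof
      assume "rank k \<J> = k"
      moreover have "card ({1..k} - {x}) = k - 1" using x(1) by simp
      ultimately obtain B where B: "B \<in> \<J>" "{1..k} - {x} \<subseteq> B"
        using covered_if_card_less_rank[of "{1..k} - {x}" k \<J>] k by auto
      then have "B = {1..k} - {x}" using proper[OF B(1)] by blast
      with B x show False by simp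
    next
      assume "rank k \<J> = k - 1 \<and> type2 k \<J>"
      with x others show False unfolding type2_def type1_def by blast
    qed
  qed
  \<comment> \<open>If \<open>j \<notin> M\<close>, the complement of \<open>j\<close> separates
    \<open>i\<close> from \<open>j\<close>. If \<open>j \<in> M\<close>, an element \<open>x\<close>
    of \<open>M\<close> different from \<open>i\<close> and \<open>j\<close> is found, and a member
    covering \<open>{1..k} - {x, j}\<close> separates them.\<close>
  have good: "{i} \<in> \<J>" if i: "i \<in> {1..k}" and M: "i \<notin> M \<or> card M \<ge> 3" for i
  proof (rule singleton_in_pattern[OF _ proper cl i])
    fix j assume j: "j \<in> {1..k}" "j \<noteq> i"
    show "\<exists>B\<in>\<J>. i \<in> B \<and> j \<notin> B"
    proof (cases "j \<in> M")
      case False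
      then have "{1..k} - {j} \<in> \<J>" using j by (simp add: M_def)
      then show ?thesis by (rule bexI[rotated]) (use i j in simp)
    next
      case True
      have "\<exists>x\<in>M. x \<noteq> j \<and> x \<noteq> i"
        using M
      proof
        assume "i \<notin> M"
        moreover have "\<exists>x\<in>M. x \<noteq> j"
        proof (rule ccontr)
          assume "\<not> ?thesis"
          then have "M \<subseteq> {j}" by blast
          with True have "M = {j}" by (intro equalityI) simp_all
          with M_not_single show False by (rule notE)
        qed
        ultimately show ?thesis by blast
      next
        assume "card M \<ge> 3"
        moreover have "card {i, j} = 2" using j by simp
        ultimately have "\<not> M \<subseteq> {i, j}" using card_mono[of "{i, j}" M] by fastforce
        then show ?thesis by blast
      qed
      then obtain x where x: "x \<in> M" "x \<noteq> j" "x \<noteq> i" by blast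
      then have "card ({1..k} - {x, j}) = k - 2"
        using j by (subst card_Diff_subset) (simp_all add: M_def)
      moreover have "k - 2 < rank k \<J>" using rk k by linarith
      ultimately have "\<exists>B\<in>\<J>. {1..k} - {x, j} \<subseteq> B"
        by (intro covered_if_card_less_rank) simp_all
      then obtain B where B: "B \<in> \<J>" "{1..k} - {x, j} \<subseteq> B" by blast
      \<comment> \<open>Otherwise \<open>B\<close>, being proper, would be the complement of
        \<open>x\<close>, which is missing because \<open>x \<in> M\<close>.\<close>
      have "j \<notin> B"
      proof
        assume "j \<in> B"
        with B(2) have "{1..k} - {x} \<subseteq> B" by blast
        with proper[OF B(1)] have "B = {1..k} - {x}" by blast
        with B(1) x(1) show False by (simp add: M_def)
      qed
      moreover have "i \<in> B" using B(2) i j x by auto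
      ultimately show ?thesis using B(1) by blast
    qed
  qed (use k in auto)
  \<comment> \<open>With at least three elements in \<open>M\<close> every index works. Otherwise
    the indices outside \<open>M\<close> work, and there are at least \<open>k - 2 \<ge> 2\<close>
    of them.\<close>
  have "\<exists>G\<subseteq>{1..k}. 2 \<le> card G \<and> (\<forall>i\<in>G. {i} \<in> \<J>)"
  proof (cases "card M \<ge> 3")
    case True
    then have "\<forall>i\<in>{1..k}. {i} \<in> \<J>" using good by blast
    moreover have "2 \<le> card {1..k}" using k by simp
    ultimately show ?thesis by blast
  next
    case False
    have "M \<subseteq> {1..k}" unfolding M_def by blast
    then have "card ({1..k} - M) = k - card M"
      using finite_subset[of M "{1..k}"] by (simp add: card_Diff_subset)
    then have "2 \<le> card ({1..k} - M)" using False k by linarith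
    moreover have "\<forall>i\<in>{1..k} - M. {i} \<in> \<J>" using good by blast
    ultimately show ?thesis by blast
  qed
  then obtain G where G: "G \<subseteq> {1..k}" "2 \<le> card G" "\<And>i. i \<in> G \<Longrightarrow> {i} \<in> \<J>" by blast
  obtain G' where G': "G' \<subseteq> G" "card G' = 2" using obtain_subset_with_card_n[OF G(2)] .
  then obtain a b where "G' = {a, b}" "a \<noteq> b" by (metis card_2_iff)
  then show ?thesis using that[of a b] G(1,3) G'(1) by blast
qed

text \<open>The parts cover \<open>F\<close>, so the pattern confines the intersection to
  \<open>X i\<close>, where \<open>F\<close> has only the vertex \<open>v\<close>.\<close>

lemma inter_eq_part_if_pattern_singleton:
  assumes kp: "k_partite n k X \<F>" and F: "F \<in> \<F>"
    and pat: "pattern k X (F \<inter> F') = {i}" and v: "v \<in> F" "v \<in> X i"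
  shows "F \<inter> F' = {v}"
proof -
  have i: "i \<in> {1..k}" "F \<inter> F' \<inter> X i \<noteq> {}" using pat by (auto simp: pattern_def)
  have "card (F \<inter> X i) = 1" using kp F i(1) by (auto simp: k_partite_def)
  then obtain z where "F \<inter> X i = {z}" by (auto simp: card_1_singleton_iff)
  then have Fi: "F \<inter> X i = {v}" using v by (metis IntI singletonD)
  have "F \<subseteq> (\<Union>j\<in>{1..k}. X j)"
    using kp F by (auto simp: k_partite_def uniform_family_def partition_into_def)
  moreover have "F \<inter> F' \<inter> X j = {}" if "j \<in> {1..k}" "j \<noteq> i" for j
    using pat that unfolding pattern_def by blast
  ultimately have "F \<inter> F' \<subseteq> X i" by blast
  then have "F \<inter> F' \<subseteq> {v}" "F \<inter> F' \<noteq> {}" using Fi i(2) by auto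
  then show ?thesis by (simp add: subset_singleton_iff)
qed

theorem theorem3p8:
  fixes n k s q :: nat
    and V :: "'v set" and E :: "'v set set"
    and \<F> \<J> :: "nat set set"
  assumes "k \<ge> 4" and "q > 0" and "s > 0" and "s \<ge> k * q"
    and "is_tree V E" and "card E = q"
    and "homogeneous n k s \<F> \<J>" and "\<F> \<noteq> {}"
    and "rank k \<J> = k \<or> (rank k \<J> = k - 1 \<and> type2 k \<J>)"
  shows "contains_copy \<F> (blowup k E)"
proof -
  obtain X where kp: "k_partite n k X \<F>"
    and J: "\<forall>B\<in>\<J>. B \<subset> {1..k}" "\<forall>B\<in>\<J>. \<forall>C\<in>\<J>. B \<inter> C \<in> \<J>"
    and pat: "\<forall>F\<in>\<F>. pattern k X ` intersections F \<F> = \<J>"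
    and star: "\<forall>F\<in>\<F>. \<forall>A\<in>intersections F \<F>. \<exists>S\<subseteq>\<F>. F \<in> S \<and> is_star s A S"
    using assms(7) unfolding homogeneous_def by (elim exE conjE)
  obtain a b where ab: "a \<in> {1..k}" "b \<in> {1..k}" "a \<noteq> b" "{a} \<in> \<J>" "{b} \<in> \<J>"
    using two_singletons_in_pattern[OF assms(1) _ _ assms(9)] J by metis
  have disj: "X a \<inter> X b = {}"
    using kp ab by (auto simp: k_partite_def partition_into_def disjoint_family_on_def)
  have tree: "grown V E" by (rule tree_grown[OF assms(5)])
  have "(k - 1) * (q - 1) < k * q" using assms(1,2) by (intro mult_strict_mono) auto
  then have s: "(k - 1) * (q - 1) < s" using assms(4) by simp
  have "\<exists>f. inj_on f (blowup_vertices k V E) \<and> (\<forall>w\<in>V. f (Inl w) \<in> (X a \<union> X b) \<inter> \<Union>\<F>) \<and>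
    (\<forall>e\<in>E. f ` blowup_edge k e \<in> \<F>)"
  proof (rule grown_blowup_embedding[OF tree _ _ s assms(8)])
    fix F v assume F: "F \<in> \<F>" "v \<in> F" "v \<in> X a \<union> X b"
    then obtain i where i: "{i} \<in> \<J>" "v \<in> X i" using ab by blast
    \<comment> \<open>The pattern family is the same at every member, so \<open>{i}\<close> is
      realised by an intersection with this very \<open>F\<close>.\<close>
    then obtain A where A: "A \<in> intersections F \<F>" "pattern k X A = {i}"
      using pat F(1) by (metis imageE)
    then obtain F' where "A = F \<inter> F'" by (auto simp: intersections_def)
    then have "A = {v}" using inter_eq_part_if_pattern_singleton[OF kp F(1)] A F i by blast
    then show "\<exists>S\<subseteq>\<F>. F \<in> S \<and> is_star s {v} S" using star F(1) A(1) by blast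
  next
    fix F v assume F: "F \<in> \<F>"
    then have "card (F \<inter> X a) = 1" "card (F \<inter> X b) = 1"
      using kp ab by (auto simp: k_partite_def)
    then obtain x y where xy: "x \<in> F \<inter> X a" "y \<in> F \<inter> X b"
      by (metis card_1_singletonE insertI1)
    then have "x \<noteq> y" using disj by blast
    \<comment> \<open>At most one of the distinct vertices \<open>x\<close> and \<open>y\<close> can
      equal \<open>v\<close>; the other is the witness.\<close>
    with xy show "\<exists>w\<in>F \<inter> (X a \<union> X b). w \<noteq> v" by (cases "x = v") auto
  next
    fix F assume "F \<in> \<F>"
    then show "card F = k" using kp by (auto simp: k_partite_def uniform_family_def)
  qed (use assms in auto)
  then obtain f where f: "inj_on f (blowup_vertices k V E)"
    "\<And>e. e \<in> E \<Longrightarrow> f ` blowup_edge k e \<in> \<F>" by blast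
  have "\<Union>(blowup k E) \<subseteq> blowup_vertices k V E"
    using grown_finite(3)[OF tree]
    by (auto simp: blowup_def blowup_edge_def blowup_vertices_def)
  then have "inj_on f (\<Union>(blowup k E))" using f(1) inj_on_subset by blast
  then show ?thesis using f(2) by (intro contains_copyI) (auto simp: blowup_def)
qed

end
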